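(* Let $1\le k<n-1$. A complex $n\times n$ matrix $B$ is in the degenerate locus for $G(k,n)$ if and only if there exist $k$ eigenvalues $\lambda_1,\dots,\lambda_k$ of $B$ (chosen, counting multiplicity, from the $n$ eigenvalues of $B$) such that $\sum_{i=1}^k\lambda_i=-1$.
   Context: $V=\mathbb C^n$, $G(k,n)$ is the Grassmannian of $k$-planes in $V$, $\mathcal S$ the tautological subbundle, $\mathcal V$ the trivial bundle with fibre $V$. For an $n\times n$ matrix $B$ (acting on $V$), $f_B:\mathcal V^*\otimes\mathcal S\to\mathcal S^*\otimes\mathcal S$ is the bundle map $f_B(\xi\otimes s)=\xi|_{\mathcal S}\otimes s+\xi(Bs)\,\mathrm{id}_{\mathcal S}$. The degenerate locus for $G(k,n)$ is the set of $B$ for which $f_B$ fails to define a deformed (co)tangent bundle, i.e. for which $f_B$ fails to have rank $k^2$ (to be surjective) on the fibre at some point of $G(k,n)$. *)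

theory Defs
  imports "HOL-Analysis.Analysis" "HOL-Computational_Algebra.Computational_Algebra"
begin

text \<open>Throughout, \<open>V = complex^'n\<close>, with \<open>n = CARD('n)\<close>; \<open>vec.subspace\<close>, \<open>vec.dim\<close> are the
  complex notions.\<close>

definition grassmannian :: "nat \<Rightarrow> (complex^'n) set set" where
  "grassmannian k = {S. vec.subspace S \<and> vec.dim S = k}"

definition dual_V :: "(complex^'n \<Rightarrow> complex) set" where
  "dual_V = {\<xi>. Vector_Spaces.linear (*s) (*) \<xi>}"

text \<open>The fibre of \<open>V* \<otimes> S\<close> at a point \<open>S\<close> of the Grassmannian is realised as \<open>Hom(V, S)\<close>, the
  decomposable tensor \<open>\<xi> \<otimes> s\<close> being the map \<open>v \<mapsto> \<xi>(v) s\<close>.\<close>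

definition pure_tensor :: "(complex^'n \<Rightarrow> complex) \<Rightarrow> complex^'n \<Rightarrow> (complex^'n \<Rightarrow> complex^'n)" where
  "pure_tensor \<xi> s = (\<lambda>v. \<xi> v *s s)"

definition V_dual_tensor :: "(complex^'n) set \<Rightarrow> (complex^'n \<Rightarrow> complex^'n) set" where
  "V_dual_tensor S = {\<phi>. Vector_Spaces.linear (*s) (*s) \<phi> \<and> range \<phi> \<subseteq> S}"

text \<open>The fibre of \<open>S* \<otimes> S\<close> is realised as \<open>End(S)\<close>: linear maps with domain \<open>S\<close>, made extensional
  so that equality is equality on \<open>S\<close>. This is also the identification under which \<open>id\<close> is an
  element of \<open>S* \<otimes> S\<close>.\<close>

definition S_dual_tensor :: "(complex^'n) set \<Rightarrow> (complex^'n \<Rightarrow> complex^'n) set" where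
  "S_dual_tensor S = {\<psi> \<in> S \<rightarrow>\<^sub>E S.
     (\<forall>x\<in>S. \<forall>y\<in>S. \<psi> (x + y) = \<psi> x + \<psi> y) \<and> (\<forall>c. \<forall>x\<in>S. \<psi> (c *s x) = c *s \<psi> x)}"

text \<open>\<open>\<xi>|\<^sub>S \<otimes> s + \<xi>(B s) id\<^sub>S\<close>\<close>

definition f_pure ::
    "complex^'n^'n \<Rightarrow> (complex^'n) set \<Rightarrow> (complex^'n \<Rightarrow> complex) \<Rightarrow> complex^'n
      \<Rightarrow> (complex^'n \<Rightarrow> complex^'n)" where
  "f_pure B S \<xi> s = (\<lambda>v\<in>S. \<xi> v *s s + \<xi> (B *v s) *s v)"

text \<open>The fibre of \<open>f\<^sub>B\<close> at \<open>S\<close>, i.e. the linear extension of \<open>\<xi> \<otimes> s \<mapsto> f_pure B S \<xi> s\<close>: write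
  \<open>\<phi> = \<Sum>i. e\<^sub>i* \<otimes> \<phi>(e\<^sub>i)\<close>. Lemmas \<open>f_fibre_pure\<close> and \<open>f_fibre_unique\<close> show that it is the unique
  linear map with the prescribed values on decomposable tensors.\<close>

definition f_fibre ::
    "complex^'n^'n \<Rightarrow> (complex^'n) set \<Rightarrow> (complex^'n \<Rightarrow> complex^'n)
      \<Rightarrow> (complex^'n \<Rightarrow> complex^'n)" where
  "f_fibre B S \<phi> = (\<lambda>v\<in>S. \<Sum>i\<in>UNIV. f_pure B S (\<lambda>w. w $ i) (\<phi> (axis i 1)) v)"

definition degenerate_locus :: "nat \<Rightarrow> (complex^'n^'n) set" where
  "degenerate_locus k =
     {B. \<exists>S\<in>grassmannian k. f_fibre B S ` V_dual_tensor S \<noteq> S_dual_tensor S}"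

definition charpoly :: "complex^'n^'n \<Rightarrow> complex poly" where
  "charpoly B = det (mat [:0, 1:] - (\<chi> i j. [:B $ i $ j:]))"

definition eigenvalues :: "complex^'n^'n \<Rightarrow> complex multiset" where
  "eigenvalues B = proots (charpoly B)"

lemma dual_V_expand:
  fixes \<xi> :: "complex^'n \<Rightarrow> complex"
  assumes "\<xi> \<in> dual_V"
  shows "\<xi> v = (\<Sum>i\<in>UNIV. v $ i * \<xi> (axis i 1))"
proof -
  interpret Vector_Spaces.linear "(*s)" "(*)" \<xi> using assms by (simp add: dual_V_def)
  have "\<xi> v = \<xi> (\<Sum>i\<in>UNIV. (v $ i) *s axis i 1)" by (simp add: basis_expansion)
  also have "\<dots> = (\<Sum>i\<in>UNIV. v $ i * \<xi> (axis i 1))" by (simp add: sum scale)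
  finally show ?thesis .
qed

lemma V_dual_tensor_expand:
  fixes \<phi> :: "complex^'n \<Rightarrow> complex^'n"
  assumes "\<phi> \<in> V_dual_tensor S"
  shows "\<phi> = (\<lambda>v. \<Sum>i\<in>UNIV. pure_tensor (\<lambda>w. w $ i) (\<phi> (axis i 1)) v)"
proof
  fix v
  interpret Vector_Spaces.linear "(*s)" "(*s)" \<phi> using assms by (simp add: V_dual_tensor_def)
  have "\<phi> v = \<phi> (\<Sum>i\<in>UNIV. (v $ i) *s axis i 1)" by (simp add: basis_expansion)
  also have "\<dots> = (\<Sum>i\<in>UNIV. v $ i *s \<phi> (axis i 1))" by (simp add: sum scale)
  finally show "\<phi> v = (\<Sum>i\<in>UNIV. pure_tensor (\<lambda>w. w $ i) (\<phi> (axis i 1)) v)"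
    by (simp add: pure_tensor_def)
qed

lemma coord_in_dual_V: "(\<lambda>w. w $ i) \<in> dual_V"
  by (simp add: dual_V_def) (unfold_locales; simp add: algebra_simps)

lemma pure_tensor_in_V_dual_tensor:
  assumes "\<xi> \<in> dual_V" "s \<in> S" "vec.subspace S"
  shows "pure_tensor \<xi> s \<in> V_dual_tensor S"
proof -
  interpret Vector_Spaces.linear "(*s)" "(*)" \<xi> using assms by (simp add: dual_V_def)
  have "Vector_Spaces.linear (*s) (*s) (pure_tensor \<xi> s)"
    by unfold_locales (simp_all add: pure_tensor_def add scale vec.scale_left_distrib)
  then show ?thesis
    using assms by (auto simp: V_dual_tensor_def pure_tensor_def vec.subspace_scale)
qed

lemma f_fibre_pure:
  assumes "\<xi> \<in> dual_V" "s \<in> S"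
  shows "f_fibre B S (pure_tensor \<xi> s) = f_pure B S \<xi> s"
proof
  fix v
  interpret \<xi>: Vector_Spaces.linear "(*s)" "(*)" \<xi> using assms by (simp add: dual_V_def)
  show "f_fibre B S (pure_tensor \<xi> s) v = f_pure B S \<xi> s v"
  proof (cases "v \<in> S")
    case True
    have "f_fibre B S (pure_tensor \<xi> s) v =
        (\<Sum>i\<in>UNIV. v $ i * \<xi> (axis i 1)) *s s + (\<Sum>i\<in>UNIV. (B *v s) $ i * \<xi> (axis i 1)) *s v"
      using True
      by (simp add: f_fibre_def f_pure_def pure_tensor_def sum.distrib vec.scale_sum_left
          vec.scale mult.commute)
    then show ?thesis
      using True dual_V_expand[OF assms(1), of v] dual_V_expand[OF assms(1), of "B *v s"]
      by (simp add: f_pure_def)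
  qed (simp add: f_fibre_def f_pure_def)
qed

lemma f_fibre_add:
  "f_fibre B S (\<lambda>v. \<phi> v + \<phi>' v) = (\<lambda>v\<in>S. f_fibre B S \<phi> v + f_fibre B S \<phi>' v)"
  by (rule ext)
    (simp add: f_fibre_def f_pure_def sum.distrib vec.add vec.scale_left_distrib
      vec.scale_right_distrib algebra_simps)

lemma f_fibre_scale:
  "f_fibre B S (\<lambda>v. c *s \<phi> v) = (\<lambda>v\<in>S. c *s f_fibre B S \<phi> v)"
  by (rule ext)
    (simp add: f_fibre_def f_pure_def vec.scale vec.scale_sum_right vec.scale_right_distrib
      mult.commute)

lemma f_fibre_in_S_dual_tensor:
  assumes "vec.subspace S" "\<phi> \<in> V_dual_tensor S"
  shows "f_fibre B S \<phi> \<in> S_dual_tensor S"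
proof -
  have *: "\<phi> v \<in> S" for v using assms(2) by (auto simp: V_dual_tensor_def)
  have "f_fibre B S \<phi> \<in> S \<rightarrow>\<^sub>E S"
    using assms(1)
    by (auto simp: f_fibre_def f_pure_def intro!: vec.subspace_sum vec.subspace_add
        vec.subspace_scale *)
  then show ?thesis
    using assms(1)
    by (auto simp: S_dual_tensor_def f_fibre_def f_pure_def vec.subspace_add vec.subspace_scale
        sum.distrib vec.scale_left_distrib vec.scale_right_distrib vec.scale_sum_right algebra_simps)
qed

lemma f_fibre_unique:
  assumes S: "vec.subspace S" and \<phi>: "\<phi> \<in> V_dual_tensor S"
    and add: "\<And>\<phi> \<phi>'. \<phi> \<in> V_dual_tensor S \<Longrightarrow> \<phi>' \<in> V_dual_tensor S \<Longrightarrow>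
      F (\<lambda>v. \<phi> v + \<phi>' v) = (\<lambda>v\<in>S. F \<phi> v + F \<phi>' v)"
    and scale: "\<And>c \<phi>. \<phi> \<in> V_dual_tensor S \<Longrightarrow> F (\<lambda>v. c *s \<phi> v) = (\<lambda>v\<in>S. c *s F \<phi> v)"
    and pure: "\<And>\<xi> s. \<xi> \<in> dual_V \<Longrightarrow> s \<in> S \<Longrightarrow> F (pure_tensor \<xi> s) = f_pure B S \<xi> s"
  shows "F \<phi> = f_fibre B S \<phi>"
proof -
  have \<phi>S: "\<phi> v \<in> S" for v using \<phi> by (auto simp: V_dual_tensor_def)
  have zero: "(\<lambda>v. 0) \<in> V_dual_tensor S"
    using S by (auto simp: V_dual_tensor_def vec.subspace_0) (unfold_locales; simp)
  have plus: "(\<lambda>v. \<phi>1 v + \<phi>2 v) \<in> V_dual_tensor S"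
    if "\<phi>1 \<in> V_dual_tensor S" "\<phi>2 \<in> V_dual_tensor S" for \<phi>1 \<phi>2
    using that S
    by (auto simp: V_dual_tensor_def intro!: vec.linear_compose_add vec.subspace_add)
  let ?t = "\<lambda>i. pure_tensor (\<lambda>w. w $ i) (\<phi> (axis i 1))"
  have t: "?t i \<in> V_dual_tensor S" for i
    using coord_in_dual_V \<phi>S S by (rule pure_tensor_in_V_dual_tensor)
  have "(\<lambda>v. \<Sum>i\<in>I. ?t i v) \<in> V_dual_tensor S \<and>
      F (\<lambda>v. \<Sum>i\<in>I. ?t i v) = (\<lambda>v\<in>S. \<Sum>i\<in>I. f_pure B S (\<lambda>w. w $ i) (\<phi> (axis i 1)) v)"
    if "finite I" for I
    using that
  proof (induction I)
    case empty
    show ?case using zero scale[OF zero, of 0] by simp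
  next
    case (insert i I)
    then show ?case
      using plus[OF t[of i]] add[OF t[of i]] pure[OF coord_in_dual_V \<phi>S]
      by (simp cong: restrict_cong)
  qed
  from this[of UNIV] show ?thesis
    using V_dual_tensor_expand[OF \<phi>] by (simp add: f_fibre_def)
qed

lemma degree_charpoly:
  fixes B :: "complex^'n^'n"
  shows "degree (charpoly B) = CARD('n)" and "coeff (charpoly B) CARD('n) = 1"
proof -
  let ?M = "mat [:0, 1:] - (\<chi> i j. [:B $ i $ j:]) :: complex poly^'n^'n"
  let ?t = "\<lambda>p. of_int (sign p) * (\<Prod>i\<in>UNIV. ?M $ i $ p i)"
  have M: "?M $ i $ j = (if i = j then [:- B $ i $ j, 1:] else [:- B $ i $ j:])" for i j
    by (simp add: mat_def)
  have deg: "degree (?t p) \<le> (\<Sum>i\<in>UNIV. if p i = i then 1 else 0)" for p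
  proof -
    have "degree (?t p) \<le> degree (of_int (sign p) :: complex poly) + degree (\<Prod>i\<in>UNIV. ?M $ i $ p i)"
      by (rule degree_mult_le)
    also have "\<dots> = degree (\<Prod>i\<in>UNIV. ?M $ i $ p i)" by simp
    also have "\<dots> \<le> sum (degree \<circ> (\<lambda>i. ?M $ i $ p i)) UNIV"
      by (rule degree_prod_sum_le) simp
    also have "\<dots> \<le> (\<Sum>i\<in>UNIV. if p i = i then 1 else 0)"
      by (rule sum_mono) (unfold o_apply M, auto)
    finally show ?thesis .
  qed
  have small: "coeff (?t p) CARD('n) = 0" if "p \<noteq> id" for p
  proof -
    from that obtain j where j: "p j \<noteq> j" by (auto simp: fun_eq_iff)
    have "(\<Sum>i\<in>UNIV. if p i = i then 1 else 0) < (\<Sum>i\<in>(UNIV :: 'n set). 1 :: nat)"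
      by (rule sum_strict_mono_ex1) (use j in auto)
    with deg[of p] show ?thesis by (intro coeff_eq_0) simp
  qed
  have big: "coeff (?t id) CARD('n) = 1"
  proof -
    let ?q = "\<Prod>i\<in>(UNIV :: 'n set). [:- B $ i $ i, 1:]"
    have "?t id = ?q" unfolding M by simp
    moreover have "degree ?q = CARD('n)" by (simp add: degree_prod_sum_eq)
    moreover have "lead_coeff ?q = 1" by (simp only: lead_coeff_prod) simp
    ultimately show ?thesis by simp
  qed
  have cp: "charpoly B = (\<Sum>p | p permutes UNIV. ?t p)"
    by (simp only: charpoly_def det_def)
  have "degree (?t p) \<le> CARD('n)" for p
  proof -
    have "(\<Sum>i\<in>UNIV. if p i = i then 1 else 0) \<le> (\<Sum>i\<in>(UNIV :: 'n set). 1 :: nat)"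
      by (rule sum_mono) simp
    with deg[of p] show ?thesis by (elim order_trans) simp
  qed
  then have le: "degree (charpoly B) \<le> CARD('n)"
    unfolding cp by (intro degree_sum_le) (auto simp: finite_permutations)
  have "coeff (charpoly B) CARD('n) = (\<Sum>p | p permutes (UNIV :: 'n set). coeff (?t p) CARD('n))"
    unfolding cp by (rule coeff_sum)
  also have "\<dots> = (\<Sum>p | p permutes (UNIV :: 'n set). if p = id then 1 else 0)"
    by (intro sum.cong refl) (use small big in presburger)
  also have "\<dots> = 1"
    by (simp add: sum.delta finite_permutations permutes_id)
  finally show *: "coeff (charpoly B) CARD('n) = 1" .
  with le show "degree (charpoly B) = CARD('n)"
    by (metis le_antisym le_degree zero_neq_one)
qed

lemma size_eigenvalues: "size (eigenvalues (B :: complex^'n^'n)) = CARD('n)"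
  by (simp add: eigenvalues_def size_proots_complex degree_charpoly)

lemma eigenvalues_iff:
  fixes B :: "complex^'n^'n"
  shows "x \<in># eigenvalues B \<longleftrightarrow> (\<exists>v. v \<noteq> 0 \<and> B *v v = x *s v)"
proof -
  have nz: "charpoly B \<noteq> 0"
    using degree_charpoly(2)[of B] by auto
  have "poly ((mat [:0, 1:] - (\<chi> i j. [:B $ i $ j:]) :: complex poly^'n^'n) $ i $ j) x
      = (mat x - B) $ i $ j" for i j
    by (simp add: mat_def)
  then have p: "poly (charpoly B) x = det (mat x - B)"
    unfolding charpoly_def det_def by (simp only: poly_sum poly_mult poly_prod poly_of_int)
  have "x \<in># eigenvalues B \<longleftrightarrow> det (mat x - B) = 0"
    using nz p by (simp add: eigenvalues_def)
  also have "\<dots> \<longleftrightarrow> (\<exists>v. v \<noteq> 0 \<and> (mat x - B) *v v = 0)"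
    by (metis invertible_det_nz invertible_left_inverse matrix_left_invertible_ker)
  also have "\<dots> \<longleftrightarrow> (\<exists>v. v \<noteq> 0 \<and> B *v v = x *s v)"
  proof -
    have "mat x *v v = x *s v" for v :: "complex^'n"
      by (simp add: vec_eq_iff matrix_vector_mult_def mat_def if_distrib if_distribR cong: if_cong)
    then show ?thesis by (metis matrix_vector_mult_diff_rdistrib eq_iff_diff_eq_0)
  qed
  finally show ?thesis .
qed

end

theory Submission
  imports Defs
begin

text \<open>
  Under the trace pairing, a functional on \<open>End(S)\<close> that kills the image of the fibre of \<open>f\<^sub>B\<close> is
  an endomorphism \<open>A\<close> of \<open>S\<close> with \<open>A = - tr(A) B\<close> on \<open>S\<close>. A nonzero one exists exactly when \<open>S\<close>
  is \<open>B\<close>-invariant and \<open>tr(B|\<^sub>S) = -1\<close>. Concretely, the fibre at \<open>S\<close> maps \<open>\<phi>\<close> to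
  \<open>\<phi>|\<^sub>S + tr(B\<phi>) id\<close>, so it is surjective iff \<open>id\<close> is in its image: for \<open>S\<close> not invariant take
  \<open>\<xi> \<otimes> s\<close> with \<open>\<xi>\<close> vanishing on \<open>S\<close> and \<open>\<xi>(Bs) = 1\<close>, otherwise a multiple of a projection onto
  \<open>S\<close>. The traces of \<open>B\<close> on invariant \<open>k\<close>-planes are the sums of \<open>k\<close> eigenvalues, because a
  \<open>B\<close>-invariant complete flag can be built with the eigenvalues in any prescribed order.
\<close>

section \<open>Polynomials in \<open>B\<close> and eigenvectors modulo a subspace\<close>

text \<open>This is p(B)u. Only its effect on a single vector matters, so iterates of
  \<open>B\<close> on \<open>u\<close> replace powers of the matrix.\<close>

definition poly_act :: "complex^'n^'n \<Rightarrow> complex poly \<Rightarrow> complex^'n \<Rightarrow> complex^'n" where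
  "poly_act B p u = (\<Sum>i\<le>degree p. coeff p i *s ((*v) B ^^ i) u)"

lemma poly_act_altdef:
  assumes "degree p \<le> N"
  shows "poly_act B p u = (\<Sum>i\<le>N. coeff p i *s ((*v) B ^^ i) u)"
  unfolding poly_act_def using assms
  by (intro sum.mono_neutral_left) (auto simp: coeff_eq_0 not_le)

lemma poly_act_linear_factor:
  "poly_act B ([:- \<mu>, 1:] * q) u = B *v poly_act B q u - \<mu> *s poly_act B q u"
proof -
  let ?b = "\<lambda>i. ((*v) B ^^ i) u"
  have "degree ([:- \<mu>, 1:] * q) \<le> Suc (degree q)"
    using degree_mult_le[of "[:- \<mu>, 1:]" q] by simp
  then have "poly_act B ([:- \<mu>, 1:] * q) u =
      (\<Sum>i\<le>Suc (degree q). coeff ([:- \<mu>, 1:] * q) i *s ?b i)"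
    by (rule poly_act_altdef)
  also have "\<dots> = (\<Sum>i\<le>Suc (degree q). coeff (pCons 0 q) i *s ?b i - \<mu> *s (coeff q i *s ?b i))"
  proof (rule sum.cong)
    fix i
    have "coeff ([:- \<mu>, 1:] * q) i = coeff (pCons 0 q) i - \<mu> * coeff q i" by simp
    then show "coeff ([:- \<mu>, 1:] * q) i *s ?b i
        = coeff (pCons 0 q) i *s ?b i - \<mu> *s (coeff q i *s ?b i)"
      by (simp only: vec.scale_left_diff_distrib vec.scale_scale)
  qed simp
  also have "\<dots> = (\<Sum>i\<le>Suc (degree q). coeff (pCons 0 q) i *s ?b i)
      - \<mu> *s (\<Sum>i\<le>Suc (degree q). coeff q i *s ?b i)"
    by (simp only: sum_subtractf vec.scale_sum_right)
  \<comment> \<open>Shifting the coefficients by \<open>pCons 0\<close> amounts to one further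
    application of \<open>B\<close>.\<close>
  also have "(\<Sum>i\<le>Suc (degree q). coeff (pCons 0 q) i *s ?b i) = B *v poly_act B q u"
    unfolding sum.atMost_Suc_shift poly_act_def vec.sum vec.scale by simp
  also have "(\<Sum>i\<le>Suc (degree q). coeff q i *s ?b i) = poly_act B q u"
    by (rule poly_act_altdef[symmetric]) simp
  finally show ?thesis .
qed

lemma poly_act_in_subspace:
  assumes "vec.subspace U" "(*v) B ` U \<subseteq> U" "u \<in> U"
  shows "poly_act B p u \<in> U"
proof -
  have "((*v) B ^^ i) u \<in> U" for i
    using assms(2,3) by (induction i) auto
  then show ?thesis
    unfolding poly_act_def using assms(1) by (intro vec.subspace_sum vec.subspace_scale)
qed

text \<open>The n+1 vectors u, Bu, ..., B^n u in an n-dimensional space satisfy a linear relation,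
  whose coefficients form \<open>p\<close>. Dependence is a property of sets and does not see
  repeated iterates, hence the case distinction on injectivity.\<close>

lemma annihilating_poly_exists:
  fixes B :: "complex^'n^'n"
  obtains p where "p \<noteq> 0" "poly_act B p u = 0"
proof (cases "inj_on (\<lambda>i. ((*v) B ^^ i) u) {..CARD('n)}")
  case True
  let ?b = "\<lambda>i. ((*v) B ^^ i) u"
  let ?S = "?b ` {..CARD('n)}"
  have "card ?S = Suc CARD('n)"
    using True by (simp add: card_image)
  moreover have "vec.dim ?S \<le> CARD('n)"
    using vec.dim_subset_UNIV[of ?S] by (simp add: vec.dimension_def card_cart_basis)
  ultimately have "card ?S \<noteq> vec.dim ?S" by linarith
  then have "vec.dependent ?S"
    using vec.dim_eq_card_independent by metis
  then obtain c v where c: "v \<in> ?S" "c v \<noteq> 0" "(\<Sum>v\<in>?S. c v *s v) = 0"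
    using vec.dependent_finite[of ?S] by blast
  define p where "p = (\<Sum>i\<le>CARD('n). monom (c (?b i)) i)"
  have p: "coeff p i = (if i \<le> CARD('n) then c (?b i) else 0)" for i
    by (simp add: p_def coeff_sum)
  have "degree p \<le> CARD('n)"
    by (rule degree_le) (simp add: p)
  then have "poly_act B p u = (\<Sum>i\<le>CARD('n). coeff p i *s ?b i)"
    by (rule poly_act_altdef)
  also have "\<dots> = (\<Sum>v\<in>?S. c v *s v)"
    unfolding sum.reindex[OF True] by (simp add: p)
  finally have "poly_act B p u = 0"
    using c by simp
  moreover have "p \<noteq> 0"
  proof
    assume "p = 0"
    then have "c (?b i) = 0" if "i \<le> CARD('n)" for i
      using p[of i] that by simp
    then show False using c(1,2) by auto
  qed
  ultimately show ?thesis by (rule that[rotated])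
next
  case False
  let ?b = "\<lambda>i. ((*v) B ^^ i) u"
  obtain i j where ij: "i < j" "?b i = ?b j"
  proof -
    from False obtain i j where "i \<noteq> j" "?b i = ?b j" unfolding inj_on_def by blast
    then show ?thesis using that[of i j] that[of j i] by (cases i j rule: linorder_cases) auto
  qed
  \<comment> \<open>A repetition B^i u = B^j u is itself a relation, given by X^i - X^j.\<close>
  define p :: "complex poly" where "p = monom 1 i - monom 1 j"
  have "degree p \<le> j"
    unfolding p_def using ij(1) by (intro degree_diff_le) (auto simp: degree_monom_eq)
  then have "poly_act B p u = (\<Sum>l\<le>j. coeff p l *s ?b l)"
    by (rule poly_act_altdef)
  also have "\<dots> = (\<Sum>l\<le>j. if l = i then ?b l else 0) - (\<Sum>l\<le>j. if l = j then ?b l else 0)"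
    unfolding sum_subtractf[symmetric]
    by (intro sum.cong refl) (use ij in \<open>auto simp: p_def\<close>)
  also have "\<dots> = 0"
    using ij by simp
  finally have "poly_act B p u = 0" .
  moreover have "coeff p i \<noteq> 0" using ij(1) by (simp add: p_def)
  then have "p \<noteq> 0" by auto
  ultimately show ?thesis by (rule that[rotated])
qed

text \<open>Let \<open>p\<close> have least degree among the nonzero polynomials with p(B)u in
  \<open>W\<close>, and split off a root: p = (X - \<mu>) q. By minimality q(B)u lies outside
  \<open>W\<close>, while B - \<mu> sends it to p(B)u in \<open>W\<close>.\<close>

lemma eigenvector_mod_subspace:
  fixes B :: "complex^'n^'n"
  assumes W: "vec.subspace W"
    and U: "vec.subspace U" "(*v) B ` U \<subseteq> U" and "W \<subset> U"
  obtains v \<mu> where "v \<in> U" "v \<notin> W" "B *v v - \<mu> *s v \<in> W"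
proof -
  obtain u where u: "u \<in> U" "u \<notin> W" using \<open>W \<subset> U\<close> by auto
  obtain p0 where p0: "p0 \<noteq> 0" "poly_act B p0 u = 0" by (rule annihilating_poly_exists)
  define P where "P = (\<lambda>p. p \<noteq> 0 \<and> poly_act B p u \<in> W)"
  have "P p0" using p0 vec.subspace_0[OF W] by (simp add: P_def)
  then obtain p where p: "P p" and min: "\<And>q. P q \<Longrightarrow> degree p \<le> degree q"
    using ex_has_least_nat[of P p0 degree] by blast
  \<comment> \<open>A nonzero constant would put \<open>u\<close> itself into \<open>W\<close>; so
    \<open>p\<close> has a root.\<close>
  have "degree p \<noteq> 0"
  proof
    assume "degree p = 0"
    then obtain c where "p = [:c:]" by (rule degree_eq_zeroE)
    with p have "c \<noteq> 0" "c *s u \<in> W" by (auto simp: P_def poly_act_def)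
    then show False
      using u vec.subspace_scale[OF W, of "c *s u" "inverse c"] by simp
  qed
  then obtain \<mu> where "poly p \<mu> = 0"
    using fundamental_theorem_of_algebra[of p] constant_degree[of p] by auto
  then obtain q where q: "p = [:- \<mu>, 1:] * q"
    by (metis dvdE poly_eq_0_iff_dvd)
  have "q \<noteq> 0" using p q by (auto simp: P_def)
  then have "degree p = Suc (degree q)"
    unfolding q by (subst degree_mult_eq) simp_all
  then have "poly_act B q u \<notin> W"
    using min[of q] \<open>q \<noteq> 0\<close> by (auto simp: P_def)
  moreover have "poly_act B q u \<in> U"
    using U u by (intro poly_act_in_subspace)
  moreover have "B *v poly_act B q u - \<mu> *s poly_act B q u \<in> W"
    using p unfolding P_def q poly_act_linear_factor by simp
  ultimately show ?thesis by (intro that)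
qed

section \<open>Invariant flags and the order of their eigenvalues\<close>

text \<open>\<open>M\<close> collects the eigenvalues of \<open>B\<close> on the one-dimensional quotients of a complete
  \<open>B\<close>-invariant flag from \<open>W\<close> up to \<open>U\<close>.\<close>

inductive eigenflag ::
    "complex^'n^'n \<Rightarrow> (complex^'n) set \<Rightarrow> (complex^'n) set \<Rightarrow> complex multiset \<Rightarrow> bool"
  for B W where
  base: "eigenflag B W W {#}"
| step: "eigenflag B W U M \<Longrightarrow> v \<notin> U \<Longrightarrow> B *v v - \<mu> *s v \<in> U \<Longrightarrow>
    eigenflag B W (vec.span (insert v U)) (add_mset \<mu> M)"

lemma in_span_insert_subspace:
  fixes U :: "('a::field^'n) set"
  assumes "vec.subspace U"
  shows "x \<in> vec.span (insert v U) \<longleftrightarrow> (\<exists>c. \<exists>u\<in>U. x = u + c *s v)"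
proof -
  have "x \<in> vec.span (insert v U) \<longleftrightarrow> (\<exists>c. x - c *s v \<in> U)"
    unfolding vec.span_breakdown_eq vec.span_eq_iff[THEN iffD2, OF assms] ..
  also have "\<dots> \<longleftrightarrow> (\<exists>c. \<exists>u\<in>U. x = u + c *s v)"
    by (metis add_diff_cancel_right' diff_add_cancel)
  finally show ?thesis .
qed

text \<open>The upper flag is put on top of the lower one step by step. It comes first among the
  assumptions because the induction runs over it.\<close>

lemma eigenflag_trans:
  assumes "eigenflag B U X N" "eigenflag B W U M"
  shows "eigenflag B W X (M + N)"
  using assms by (induction rule: eigenflag.induct) (auto intro: eigenflag.intros)

context
  fixes B :: "complex^'n^'n" and W
  assumes W: "vec.subspace W" and inv: "(*v) B ` W \<subseteq> W"
begin

text \<open>In each step Bv lies in \<mu>v + U, so the enlarged space stays invariant, and v outside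
  U raises the dimension by exactly one.\<close>

lemma eigenflag_invariant:
  assumes "eigenflag B W U M"
  shows "vec.subspace U \<and> W \<subseteq> U \<and> (*v) B ` U \<subseteq> U \<and> vec.dim U = vec.dim W + size M"
  using assms
proof (induction rule: eigenflag.induct)
  case base
  then show ?case using W inv by simp
next
  case (step U M v \<mu>)
  then have U: "vec.subspace U" by simp
  have "B *v (u + c *s v) \<in> vec.span (insert v U)" if "u \<in> U" for u c
  proof -
    have "B *v (u + c *s v) = (B *v u + c *s (B *v v - \<mu> *s v)) + (c * \<mu>) *s v"
      by (simp add: vec.add vec.scale vec.scale_right_diff_distrib)
    moreover have "B *v u + c *s (B *v v - \<mu> *s v) \<in> U"
      using step that U by (intro vec.subspace_add vec.subspace_scale) auto
    ultimately show ?thesis using in_span_insert_subspace[OF U] by blast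
  qed
  then have "(*v) B ` vec.span (insert v U) \<subseteq> vec.span (insert v U)"
    using in_span_insert_subspace[OF U] by auto
  moreover have "U \<subseteq> vec.span (insert v U)"
    by (auto intro: vec.span_base)
  moreover have "vec.dim (insert v U) = Suc (vec.dim U)"
    using vec.dim_insert[of v U] step.hyps(2) unfolding vec.span_eq_iff[THEN iffD2, OF U] by simp
  ultimately show ?case using step.IH by auto
qed

lemma eigenflag_exists:
  assumes "vec.subspace U" "(*v) B ` U \<subseteq> U" "W \<subseteq> U"
  shows "\<exists>M. eigenflag B W U M"
proof -
  \<comment> \<open>Generalised to a partial flag ending at \<open>X\<close>, which is extended by
    an eigenvector modulo \<open>X\<close>; the codimension of \<open>X\<close> in \<open>U\<close>
    decreases.\<close>
  have "\<exists>M. eigenflag B W U M" if "eigenflag B W X N" "X \<subseteq> U" for X N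
    using that
  proof (induction "vec.dim U - vec.dim X" arbitrary: X N rule: less_induct)
    case less
    show ?case
    proof (cases "X = U")
      case True
      then show ?thesis using less.prems by auto
    next
      case False
      note X = eigenflag_invariant[OF less.prems(1)]
      obtain v \<mu> where v: "v \<in> U" "v \<notin> X" "B *v v - \<mu> *s v \<in> X"
        using eigenvector_mod_subspace[of X U B] X assms False less.prems(2) by blast
      note flag = eigenflag.step[OF less.prems(1) v(2,3)]
      have sub: "vec.span (insert v X) \<subseteq> U"
        using v less.prems(2) assms(1) by (intro vec.span_minimal) auto
      have "vec.dim X < vec.dim (vec.span (insert v X))"
        using eigenflag_invariant[OF flag] X by simp
      moreover have "vec.dim (vec.span (insert v X)) \<le> vec.dim U"
        using sub by (rule vec.dim_subset)
      ultimately have "vec.dim U - vec.dim (vec.span (insert v X)) < vec.dim U - vec.dim X"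
        by linarith
      then show ?thesis using less.hyps flag sub by blast
    qed
  qed
  then show ?thesis using eigenflag.base assms(3) by blast
qed

text \<open>\<open>B - \<mu>\<close> acts invertibly on \<open>U/W\<close>.\<close>

lemma eigenflag_solve:
  assumes "eigenflag B W U M" "\<mu> \<notin># M" "u \<in> U"
  shows "\<exists>x\<in>U. (B *v x - \<mu> *s x) - u \<in> W"
  using assms
proof (induction arbitrary: u rule: eigenflag.induct)
  case base
  then show ?case
    using W vec.subspace_0[OF W] by (intro bexI[of _ 0]) (auto simp: vec.subspace_neg)
next
  case (step U M v \<nu>)
  have U: "vec.subspace U" using eigenflag_invariant[OF step.hyps(1)] by simp
  from step.prems have "\<nu> \<noteq> \<mu>" "\<mu> \<notin># M" by auto
  from step.prems(2) obtain c w where w: "w \<in> U" "u = w + c *s v"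
    using in_span_insert_subspace[OF U] by blast
  \<comment> \<open>Since B - \<mu> multiplies v by \<nu> - \<mu> modulo U, the vector dv accounts
    for the part cv of u.\<close>
  define d where "d = c / (\<nu> - \<mu>)"
  have d: "d * (\<nu> - \<mu>) = c" using \<open>\<nu> \<noteq> \<mu>\<close> by (simp add: d_def)
  \<comment> \<open>What remains of u after dv, including the error of v being an eigenvector only
    modulo U; it lies in U, where the induction hypothesis applies.\<close>
  define r where "r = w - d *s (B *v v - \<nu> *s v)"
  have "r \<in> U"
    unfolding r_def using U w(1) vec.subspace_scale[OF U step.hyps(3)] by (rule vec.subspace_diff)
  then obtain x where x: "x \<in> U" "(B *v x - \<mu> *s x) - r \<in> W"
    using step.IH \<open>\<mu> \<notin># M\<close> by blast
  have "(B *v (x + d *s v) - \<mu> *s (x + d *s v)) - u = (B *v x - \<mu> *s x) - r"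
    unfolding r_def w(2) d[symmetric]
    by (simp add: vec.add vec.scale vec_eq_iff algebra_simps)
  moreover have "x + d *s v \<in> vec.span (insert v U)"
    using in_span_insert_subspace[OF U] x by blast
  ultimately show ?case using x by metis
qed

text \<open>This permits reordering: any eigenvalue of the flag can be moved to its lowest step. At
  the lowest step with value \<mu>, B - \<mu> is invertible on U/W, so some x in U satisfies (B -
  \<mu>)x = (B - \<mu>)v modulo W. Then x - v is an eigenvector modulo W, outside W because v is not
  in U.\<close>

lemma eigenflag_eigenvector:
  assumes "eigenflag B W U M" "\<mu> \<in># M"
  shows "\<exists>v. v \<notin> W \<and> B *v v - \<mu> *s v \<in> W"
  using assms
proof (induction rule: eigenflag.induct)
  case base
  then show ?case by simp
next
  case (step U M v \<nu>)
  show ?case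
  proof (cases "\<mu> \<in># M")
    case True
    then show ?thesis by (rule step.IH)
  next
    case False
    then have "\<nu> = \<mu>" using step.prems by simp
    have U: "vec.subspace U" "W \<subseteq> U" using eigenflag_invariant[OF step.hyps(1)] by simp_all
    obtain x where x: "x \<in> U" "(B *v x - \<mu> *s x) - (B *v v - \<nu> *s v) \<in> W"
      using eigenflag_solve[OF step.hyps(1) False step.hyps(3)] by blast
    have "x - v \<notin> W"
    proof
      assume "x - v \<in> W"
      then have "x - (x - v) \<in> U" using vec.subspace_diff[OF U(1) x(1)] U(2) by blast
      then show False using step.hyps by simp
    qed
    moreover have "B *v (x - v) - \<mu> *s (x - v) = (B *v x - \<mu> *s x) - (B *v v - \<nu> *s v)"
      by (simp add: \<open>\<nu> = \<mu>\<close> vec.diff vec.scale_right_diff_distrib)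
    ultimately show ?thesis using x by metis
  qed
qed

end

section \<open>Determinants along a flag and the multiset of eigenvalues\<close>

lemma dim_eq_CARD_iff:
  fixes X :: "('a::field^'n) set"
  shows "vec.dim X = CARD('n) \<longleftrightarrow> vec.span X = UNIV"
  using vec.dim_eq_full[of X] by (simp add: vec.dimension_def card_cart_basis)

text \<open>The rows indexed by \<open>- K\<close> are left free so that a step of the flag can instantiate one of
  them first with \<open>A *v v\<close> and then, by row operations, with \<open>v\<close>.\<close>

lemma det_eigenflag:
  fixes A :: "complex^'n^'n"
  assumes "eigenflag A {0} U L"
  shows "\<exists>K P. inj_on P K \<and> vec.independent (P ` K) \<and> U = vec.span (P ` K) \<and>
    (\<forall>Q. (\<forall>i\<in>K. Q i = P i) \<longrightarrow>
      det (\<chi> i. if i \<in> K then A *v Q i else Q i) = prod_mset L * det (\<chi> i. Q i))"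
  using assms
proof (induction rule: eigenflag.induct)
  case base
  show ?case by (rule exI[of _ "{}"]) (simp add: vec.independent_empty)
next
  case (step U L v \<mu>)
  from step.IH obtain K P where inj: "inj_on P K" and ind: "vec.independent (P ` K)"
    and U: "U = vec.span (P ` K)"
    and IH: "\<forall>Q. (\<forall>i\<in>K. Q i = P i) \<longrightarrow>
      det (\<chi> i. if i \<in> K then A *v Q i else Q i) = prod_mset L * det (\<chi> i. Q i)"
    by (elim exE conjE)
  \<comment> \<open>As \<open>v\<close> is outside \<open>U\<close>, the rows in \<open>K\<close> do
    not span everything, so a free index \<open>j\<close> is left for \<open>v\<close>.\<close>
  have "K \<noteq> UNIV"
  proof
    assume "K = UNIV"
    then have "card (P ` K) = CARD('n)" using inj by (simp add: card_image)
    then have "vec.dim (P ` K) = CARD('n)"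
      using vec.dim_eq_card_independent[OF ind] by simp
    then have "U = UNIV" unfolding U dim_eq_CARD_iff .
    then show False using step.hyps(2) by simp
  qed
  then obtain j where j: "j \<notin> K" by blast
  let ?P = "P(j := v)" and ?K = "insert j K"
  have img: "?P ` ?K = insert v (P ` K)" using j by auto
  have v: "v \<notin> vec.span (P ` K)" using step.hyps(2) U by simp
  then have "v \<notin> P ` K" using vec.span_base by blast
  then have "inj_on ?P ?K"
    using inj_on_fun_updI[OF inj \<open>v \<notin> P ` K\<close>] \<open>v \<notin> P ` K\<close> by auto
  moreover have "vec.independent (?P ` ?K)"
    unfolding img using v ind by (rule vec.independent_insertI)
  moreover have "vec.span (insert v U) = vec.span (?P ` ?K)"
    unfolding img U by (simp only: vec.span_insert vec.span_span)
  moreover have "det (\<chi> i. if i \<in> ?K then A *v Q i else Q i) =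
      prod_mset (add_mset \<mu> L) * det (\<chi> i. Q i)" if Q: "\<forall>i\<in>?K. Q i = ?P i" for Q
  proof -
    have Qj: "Q j = v" and QK: "\<And>i. i \<in> K \<Longrightarrow> Q i = P i" using Q j by auto
    let ?Q = "Q(j := A *v v)"
    define M where "M = (\<chi> i. if i = j then \<mu> *s v else Q i)"
    have row: "row i M = (if i = j then \<mu> *s v else Q i)" for i
      by (simp add: M_def row_def vec_eq_iff)
    have "P i \<in> {row i M |i. i \<noteq> j}" if "i \<in> K" for i
    proof -
      have "P i = row i M" "i \<noteq> j" using that j QK row by auto
      then show ?thesis by blast
    qed
    then have "vec.span (P ` K) \<subseteq> vec.span {row i M |i. i \<noteq> j}"
      by (intro vec.span_mono) blast
    then have w: "A *v v - \<mu> *s v \<in> vec.span {row i M |i. i \<noteq> j}"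
      using step.hyps(3) U by blast
    \<comment> \<open>For the induction hypothesis row \<open>j\<close> is free, so A v may be
      entered there directly as the row of \<open>?Q\<close>.\<close>
    have "det (\<chi> i. if i \<in> ?K then A *v Q i else Q i) =
        det (\<chi> i. if i \<in> K then A *v ?Q i else ?Q i)"
      using Qj j by (intro arg_cong[where f = det] arg_cong[where f = vec_lambda] ext) auto
    also have "\<dots> = prod_mset L * det (\<chi> i. ?Q i)"
      by (rule IH[rule_format]) (use QK j in auto)
    also have "(\<chi> i. ?Q i) = (\<chi> i. if i = j then row j M + (A *v v - \<mu> *s v) else row i M)"
      by (intro arg_cong[where f = vec_lambda] ext) (simp add: row)
    \<comment> \<open>The difference of A v and \<mu>v lies in \<open>U\<close>, the span of the
      rows in \<open>K\<close>, so this is a row operation.\<close>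
    also have "det \<dots> = det M"
      using w by (rule det_row_span)
    also have "\<dots> = \<mu> * det (\<chi> i. if i = j then v else Q i)"
      unfolding M_def by (rule det_row_mul)
    also have "(\<chi> i. if i = j then v else Q i) = (\<chi> i. Q i)"
      using Qj by (intro arg_cong[where f = vec_lambda] ext) auto
    finally show ?thesis by (simp add: mult_ac)
  qed
  ultimately show ?case by (intro exI[of _ ?K] exI[of _ ?P] conjI allI impI)
qed

text \<open>For a full flag no row is free. With the flag basis \<open>P\<close> as rows, det P
  times det A is the determinant with rows A P_i, which equals the product of \<open>L\<close> times
  det P; and det P is nonzero.\<close>

lemma det_eq_prod_eigenflag:
  fixes A :: "complex^'n^'n"
  assumes "eigenflag A {0} UNIV L"
  shows "det A = prod_mset L"
proof -
  obtain K P where inj: "inj_on P K" and ind: "vec.independent (P ` K)"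
    and UNIV: "UNIV = vec.span (P ` K)"
    and det: "\<forall>Q. (\<forall>i\<in>K. Q i = P i) \<longrightarrow>
      det (\<chi> i. if i \<in> K then A *v Q i else Q i) = prod_mset L * det (\<chi> i. Q i)"
    using det_eigenflag[OF assms] by (elim exE conjE)
  have "vec.dim (P ` K) = CARD('n)"
    unfolding dim_eq_CARD_iff by (rule UNIV[symmetric])
  then have "card K = CARD('n)"
    using vec.dim_eq_card_independent[OF ind] inj by (simp add: card_image)
  then have K: "K = UNIV" by (simp add: card_eq_UNIV_imp_eq_UNIV)
  have "P ` K \<subseteq> rows (\<chi> i. P i)"
    by (auto simp: rows_def row_def)
  then have "vec.span (rows (\<chi> i. P i)) = UNIV"
    using UNIV vec.span_mono by blast
  then have nz: "det (\<chi> i. P i) \<noteq> 0"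
    by (simp only: invertible_det_nz[symmetric] invertible_left_inverse
        matrix_left_invertible_span_rows_gen)
  have "(\<chi> i. P i) ** transpose A = (\<chi> i. A *v P i)"
    by (simp add: vec_eq_iff matrix_matrix_mult_def matrix_vector_mult_def transpose_def mult.commute)
  then have "det (\<chi> i. P i) * det (transpose A) = det (\<chi> i. A *v P i)"
    by (simp only: det_mul[symmetric])
  also have "\<dots> = prod_mset L * det (\<chi> i. P i)"
    using det[rule_format, of P] by (simp add: K)
  finally have "det (\<chi> i. P i) * det A = prod_mset L * det (\<chi> i. P i)"
    by simp
  then show ?thesis using nz by simp
qed

text \<open>The same vectors serve for x - B, since (x - B)v - (x - \<mu>)v = -(Bv -
  \<mu>v).\<close>

lemma eigenflag_char_matrix:
  fixes B :: "complex^'n^'n"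
  assumes "eigenflag B {0} U L"
  shows "eigenflag (mat x - B) {0} U (image_mset ((-) x) L)"
  using assms
proof (induction rule: eigenflag.induct)
  case base
  show ?case using eigenflag.base by simp
next
  case (step U L v \<mu>)
  have U: "vec.subspace U"
    using eigenflag_invariant[OF _ _ step.hyps(1)] by (simp add: vec.subspace_single_0)
  have "mat x *v v = x *s v"
    by (simp add: vec_eq_iff matrix_vector_mult_def mat_def if_distrib if_distribR cong: if_cong)
  then have "(mat x - B) *v v - (x - \<mu>) *s v = x *s v - B *v v - (x *s v - \<mu> *s v)"
    by (simp only: matrix_vector_mult_diff_rdistrib vec.scale_left_diff_distrib)
  also have "\<dots> = - (B *v v - \<mu> *s v)" by simp
  finally have "(mat x - B) *v v - (x - \<mu>) *s v = - (B *v v - \<mu> *s v)" .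
  then have "(mat x - B) *v v - (x - \<mu>) *s v \<in> U"
    using vec.subspace_neg[OF U step.hyps(3)] by (simp only:)
  from eigenflag.step[OF step.IH step.hyps(2) this] show ?case by simp
qed

lemma poly_charpoly: "poly (charpoly B) x = det (mat x - B)"
proof -
  have "poly ((mat [:0, 1:] - (\<chi> i j. [:B $ i $ j:])) $ i $ j) x = (mat x - B) $ i $ j" for i j
    by (simp add: mat_def)
  then show ?thesis
    unfolding charpoly_def det_def by (simp only: poly_sum poly_mult poly_prod poly_of_int)
qed

text \<open>This is where algebraic multiplicities enter: evaluating det(x - B) along the flag at
  every x identifies the characteristic polynomial with the product of the X - \<mu>, whose roots
  with multiplicity are \<open>L\<close>.\<close>

lemma eigenvalues_eq_eigenflag:
  fixes B :: "complex^'n^'n"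
  assumes "eigenflag B {0} UNIV L"
  shows "eigenvalues B = L"
proof -
  have "poly (charpoly B) x = poly (\<Prod>\<mu>\<in>#L. [:- \<mu>, 1:]) x" for x
  proof -
    have "poly (charpoly B) x = (\<Prod>\<mu>\<in>#L. x - \<mu>)"
      unfolding poly_charpoly using eigenflag_char_matrix[OF assms] by (rule det_eq_prod_eigenflag)
    also have "\<dots> = poly (\<Prod>\<mu>\<in>#L. [:- \<mu>, 1:]) x"
      by (induction L) (simp_all add: algebra_simps)
    finally show ?thesis .
  qed
  then have "charpoly B = (\<Prod>\<mu>\<in>#L. [:- \<mu>, 1:])"
    by (simp add: poly_eq_poly_eq_iff[symmetric] fun_eq_iff)
  moreover have "proots (\<Prod>\<mu>\<in>#L. [:- \<mu>, 1:]) = L"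
  proof (induction L)
    case (add \<mu> L)
    have "(\<Prod>\<mu>\<in>#L. [:- \<mu>, 1:]) \<noteq> 0" by (auto simp: prod_mset_zero_iff)
    with add show ?case by (simp add: proots_mult del: mult_pCons_left)
  qed simp
  ultimately show ?thesis by (simp add: eigenvalues_def)
qed

text \<open>The flag grows from the bottom. Once \<open>L\<close> is realised up to
  \<open>U\<close>, completing the flag gives the remaining eigenvalues \<open>M\<close>; the next
  value \<mu> is among them and so has an eigenvector modulo \<open>U\<close>.\<close>

lemma eigenflag_of_sub_eigenvalues:
  fixes B :: "complex^'n^'n"
  assumes "L \<subseteq># eigenvalues B"
  shows "\<exists>U. eigenflag B {0} U L"
  using assms
proof (induction L)
  case empty
  show ?case using eigenflag.base by blast
next
  case (add \<mu> L)
  then obtain U where U: "eigenflag B {0} U L"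
    using subset_mset.order_trans[of L "add_mset \<mu> L"] by auto
  note inv = eigenflag_invariant[OF vec.subspace_single_0 _ U]
  obtain M where M: "eigenflag B U UNIV M"
    using eigenflag_exists[of U B UNIV] inv by auto
  have "eigenvalues B = L + M"
    using eigenflag_trans[OF M U] by (rule eigenvalues_eq_eigenflag)
  then have "L + {#\<mu>#} \<subseteq># L + M" using add.prems by simp
  then have "\<mu> \<in># M" by (simp only: subset_mset.add_le_cancel_left) simp
  then obtain v where "v \<notin> U" "B *v v - \<mu> *s v \<in> U"
    using eigenflag_eigenvector[OF _ _ M] inv by auto
  then show ?case using eigenflag.step[OF U] by blast
qed

section \<open>Functionals, projections and the trace along a flag\<close>

lemma separating_functional:
  fixes W :: "(complex^'n) set"
  assumes W: "vec.subspace W" "v \<notin> W"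
  obtains \<xi> where "\<xi> \<in> dual_V" "\<And>w. w \<in> W \<Longrightarrow> \<xi> w = 0" "\<xi> v = 1"
proof -
  interpret p: vector_space_pair "(*s) :: complex \<Rightarrow> complex^'n \<Rightarrow> _" "(*) :: complex \<Rightarrow> complex \<Rightarrow> _" ..
  obtain C where C: "C \<subseteq> W" "vec.independent C" "W \<subseteq> vec.span C"
    using vec.basis_exists[of W] by metis
  then have "vec.span C \<subseteq> W" using W by (intro vec.span_minimal)
  then have "vec.independent (insert v C)" using W C by (intro vec.independent_insertI) auto
  then obtain \<xi> where \<xi>: "Vector_Spaces.linear (*s) (*) \<xi>"
    "\<forall>x\<in>insert v C. \<xi> x = (if x = v then 1 else 0)"
    using p.linear_independent_extend[of "insert v C" "\<lambda>x. if x = v then 1 else 0"] by blast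
  interpret Vector_Spaces.linear "(*s)" "(*)" \<xi> by (rule \<xi>)
  have "\<xi> w = 0" if "w \<in> W" for w
  proof (rule eq_0_on_span)
    show "w \<in> vec.span C" using that C by blast
    show "\<xi> x = 0" if "x \<in> C" for x using \<xi> that C W by auto
  qed
  with \<xi> show ?thesis using that[of \<xi>] by (simp add: dual_V_def)
qed

lemma projection_exists:
  fixes S :: "(complex^'n) set"
  assumes "vec.subspace S"
  obtains \<pi> where "\<pi> \<in> V_dual_tensor S" "\<And>v. v \<in> S \<Longrightarrow> \<pi> v = v"
  using vec.linear_exists_left_inverse_on[OF vec.linear_id assms] that
  by (auto simp: V_dual_tensor_def)

text \<open>The sum is tr(B\<phi>). Removing from \<phi> its component along the top vector v leaves
  a map into U that is still the scalar a there; the removed rank-one part contributes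
  a\<mu>.\<close>

lemma trace_eigenflag:
  fixes B :: "complex^'n^'n"
  assumes "eigenflag B {0} S L" "\<phi> \<in> V_dual_tensor S" "\<And>v. v \<in> S \<Longrightarrow> \<phi> v = a *s v"
  shows "(\<Sum>i\<in>UNIV. (B *v \<phi> (axis i 1)) $ i) = a * sum_mset L"
  using assms
proof (induction arbitrary: \<phi> rule: eigenflag.induct)
  case base
  then have "\<phi> v = 0" for v by (auto simp: V_dual_tensor_def)
  then show ?case by simp
next
  case (step U L v \<mu>)
  have U: "vec.subspace U"
    using eigenflag_invariant[OF vec.subspace_single_0 _ step.hyps(1)] by simp
  obtain \<xi> where \<xi>: "\<xi> \<in> dual_V" "\<And>w. w \<in> U \<Longrightarrow> \<xi> w = 0" "\<xi> v = 1"
    using separating_functional[OF U step.hyps(2)] by blast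
  interpret \<xi>: Vector_Spaces.linear "(*s)" "(*)" \<xi> using \<xi> by (simp add: dual_V_def)
  interpret \<phi>: Vector_Spaces.linear "(*s)" "(*s)" \<phi> using step.prems by (simp add: V_dual_tensor_def)
  define \<psi> where "\<psi> = (\<lambda>x. \<phi> x - \<xi> (\<phi> x) *s v)"
  have "Vector_Spaces.linear (*s) (*s) \<psi>"
    by unfold_locales
      (simp_all add: \<psi>_def \<phi>.add \<phi>.scale \<xi>.add \<xi>.scale vec.scale_left_distrib
        vec.scale_right_diff_distrib)
  moreover have "\<psi> x \<in> U" for x
  proof -
    have "\<phi> x \<in> vec.span (insert v U)" using step.prems(1) by (auto simp: V_dual_tensor_def)
    then obtain c u where "u \<in> U" "\<phi> x = u + c *s v"
      using in_span_insert_subspace[OF U] by blast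
    then show ?thesis using \<xi> by (simp add: \<psi>_def \<xi>.add \<xi>.scale)
  qed
  ultimately have "\<psi> \<in> V_dual_tensor U" by (auto simp: V_dual_tensor_def)
  moreover have "\<psi> w = a *s w" if "w \<in> U" for w
    using that step.prems(2)[of w] \<xi> by (simp add: \<psi>_def \<xi>.scale vec.span_base)
  ultimately have \<psi>: "(\<Sum>i\<in>UNIV. (B *v \<psi> (axis i 1)) $ i) = a * sum_mset L"
    by (rule step.IH)
  \<comment> \<open>The rank-one part of B\<phi> sends x to \<xi>(\<phi> x) Bv, so its trace is the
    functional \<xi> \<circ> \<phi> evaluated at Bv.\<close>
  have "\<xi> \<circ> \<phi> \<in> dual_V"
    unfolding dual_V_def by (simp, unfold_locales) (simp_all add: \<phi>.add \<phi>.scale \<xi>.add \<xi>.scale)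
  note dual_V_expand[OF this, of "B *v v"]
  moreover have "B *v v = (B *v v - \<mu> *s v) + \<mu> *s v" by simp
  then have "B *v v \<in> vec.span (insert v U)"
    using step.hyps(3) in_span_insert_subspace[OF U] by blast
  then have "\<phi> (B *v v) = a *s (B *v v)" by (rule step.prems(2))
  moreover have "\<xi> (B *v v) = \<mu>"
    using \<xi>(2)[OF step.hyps(3)] \<xi>(3) by (simp add: \<xi>.diff \<xi>.scale)
  ultimately have \<xi>\<phi>: "(\<Sum>i\<in>UNIV. (B *v v) $ i * \<xi> (\<phi> (axis i 1))) = a * \<mu>"
    by (simp add: \<xi>.scale)
  have "\<phi> x = \<psi> x + \<xi> (\<phi> x) *s v" for x by (simp add: \<psi>_def)
  then have "(\<Sum>i\<in>UNIV. (B *v \<phi> (axis i 1)) $ i) =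
      (\<Sum>i\<in>UNIV. (B *v (\<psi> (axis i 1) + \<xi> (\<phi> (axis i 1)) *s v)) $ i)" by simp
  also have "\<dots> = (\<Sum>i\<in>UNIV. (B *v \<psi> (axis i 1)) $ i) + (\<Sum>i\<in>UNIV. (B *v v) $ i * \<xi> (\<phi> (axis i 1)))"
    by (simp add: vec.add vec.scale sum.distrib mult.commute)
  finally show ?case unfolding \<psi> \<xi>\<phi> by (simp add: algebra_simps)
qed

section \<open>Surjectivity of the fibre map\<close>

text \<open>The scalar \<xi>(Bs) is the trace of B composed with \<xi> \<otimes> s, so its linear
  extension is tr(B\<phi>).\<close>

lemma f_fibre_eq_trace:
  assumes "\<phi> \<in> V_dual_tensor S" "v \<in> S"
  shows "f_fibre B S \<phi> v = \<phi> v + (\<Sum>i\<in>UNIV. (B *v \<phi> (axis i 1)) $ i) *s v"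
proof -
  have "\<phi> v = (\<Sum>i\<in>UNIV. v $ i *s \<phi> (axis i 1))"
    using fun_cong[OF V_dual_tensor_expand[OF assms(1)], of v] by (simp add: pure_tensor_def)
  then show ?thesis
    using assms(2) by (simp add: f_fibre_def f_pure_def sum.distrib vec.scale_sum_left)
qed

text \<open>For a projection \<pi> onto \<open>S\<close>, the map \<psi> \<circ> \<pi> is sent to
  \<psi> plus a multiple c of the identity. A preimage \<theta> of the identity corrects this:
  subtract c\<theta>.\<close>

lemma f_fibre_surj_iff_id:
  fixes B :: "complex^'n^'n"
  assumes S: "vec.subspace S"
  shows "f_fibre B S ` V_dual_tensor S = S_dual_tensor S \<longleftrightarrow>
    (\<exists>\<phi>\<in>V_dual_tensor S. f_fibre B S \<phi> = (\<lambda>v\<in>S. v))"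
proof
  assume eq: "f_fibre B S ` V_dual_tensor S = S_dual_tensor S"
  have "(\<lambda>v\<in>S. v) \<in> S_dual_tensor S"
    using S by (auto simp: S_dual_tensor_def vec.subspace_add vec.subspace_scale)
  then show "\<exists>\<phi>\<in>V_dual_tensor S. f_fibre B S \<phi> = (\<lambda>v\<in>S. v)"
    unfolding eq[symmetric] by auto
next
  assume "\<exists>\<phi>\<in>V_dual_tensor S. f_fibre B S \<phi> = (\<lambda>v\<in>S. v)"
  then obtain \<theta> where \<theta>: "\<theta> \<in> V_dual_tensor S" "f_fibre B S \<theta> = (\<lambda>v\<in>S. v)" by blast
  obtain \<pi> where \<pi>: "\<pi> \<in> V_dual_tensor S" "\<And>v. v \<in> S \<Longrightarrow> \<pi> v = v"
    using projection_exists[OF S] by blast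
  interpret \<pi>: Vector_Spaces.linear "(*s)" "(*s)" \<pi> using \<pi> by (simp add: V_dual_tensor_def)
  interpret \<theta>: Vector_Spaces.linear "(*s)" "(*s)" \<theta> using \<theta> by (simp add: V_dual_tensor_def)
  have "\<psi> \<in> f_fibre B S ` V_dual_tensor S" if \<psi>: "\<psi> \<in> S_dual_tensor S" for \<psi>
  proof -
    have \<pi>S: "\<pi> v \<in> S" and \<theta>S: "\<theta> v \<in> S" for v
      using \<pi> \<theta> by (auto simp: V_dual_tensor_def)
    have \<psi>S: "\<psi> v \<in> S" if "v \<in> S" for v
      using \<psi> that by (auto simp: S_dual_tensor_def)
    have lin: "\<psi> (\<pi> (x + y)) = \<psi> (\<pi> x) + \<psi> (\<pi> y)" "\<psi> (\<pi> (c *s x)) = c *s \<psi> (\<pi> x)" for x y c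
      using \<psi> \<pi>S by (auto simp: S_dual_tensor_def \<pi>.add \<pi>.scale)
    have comp: "(\<lambda>v. \<psi> (\<pi> v)) \<in> V_dual_tensor S"
      unfolding V_dual_tensor_def using \<psi>S \<pi>S
      by (auto, unfold_locales) (simp_all add: lin)
    define c where "c = (\<Sum>i\<in>UNIV. (B *v \<psi> (\<pi> (axis i 1))) $ i)"
    let ?\<phi> = "\<lambda>v. \<psi> (\<pi> v) + (- c) *s \<theta> v"
    have "?\<phi> \<in> V_dual_tensor S"
      unfolding V_dual_tensor_def using \<psi>S \<pi>S \<theta>S S
      by (auto intro!: vec.subspace_diff vec.subspace_scale, unfold_locales)
        (simp_all add: lin \<theta>.add \<theta>.scale vec.scale_right_distrib vec.scale_right_diff_distrib mult.commute)
    moreover have "f_fibre B S ?\<phi> = \<psi>"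
    proof
      fix v
      show "f_fibre B S ?\<phi> v = \<psi> v"
      proof (cases "v \<in> S")
        case True
        have "f_fibre B S ?\<phi> v = f_fibre B S (\<lambda>v. \<psi> (\<pi> v)) v + (- c) *s f_fibre B S \<theta> v"
          unfolding f_fibre_add f_fibre_scale using True by simp
        then show ?thesis
          using True \<pi>(2) by (simp add: f_fibre_eq_trace[OF comp] \<theta>(2) flip: c_def)
      next
        case False
        then show ?thesis using \<psi> by (auto simp: f_fibre_def S_dual_tensor_def PiE_def extensional_def)
      qed
    qed
    ultimately show ?thesis by (metis (no_types) image_eqI)
  qed
  then show "f_fibre B S ` V_dual_tensor S = S_dual_tensor S"
    using f_fibre_in_S_dual_tensor[OF S] by blast
qed

text \<open>A flag from 0 to \<open>S\<close> encodes that \<open>S\<close> is invariant, and the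
  sum of \<open>L\<close> is then tr(B|S).\<close>

lemma not_surj_iff_eigenflag:
  fixes B :: "complex^'n^'n"
  assumes S: "vec.subspace S"
  shows "f_fibre B S ` V_dual_tensor S \<noteq> S_dual_tensor S \<longleftrightarrow>
    (\<exists>L. eigenflag B {0} S L \<and> sum_mset L = -1)"
proof
  assume not_surj: "f_fibre B S ` V_dual_tensor S \<noteq> S_dual_tensor S"
  have "(*v) B ` S \<subseteq> S"
  proof (rule ccontr)
    assume "\<not> (*v) B ` S \<subseteq> S"
    then obtain s where s: "s \<in> S" "B *v s \<notin> S" by blast
    obtain \<xi> where \<xi>: "\<xi> \<in> dual_V" "\<And>w. w \<in> S \<Longrightarrow> \<xi> w = 0" "\<xi> (B *v s) = 1"
      using separating_functional[OF S s(2)] by blast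
    have "f_fibre B S (pure_tensor \<xi> s) = (\<lambda>v\<in>S. v)"
      unfolding f_fibre_pure[OF \<xi>(1) s(1)] f_pure_def
      by (intro restrict_ext) (simp add: \<xi>)
    then show False
      using not_surj f_fibre_surj_iff_id[OF S] pure_tensor_in_V_dual_tensor[OF \<xi>(1) s(1) S] by blast
  qed
  then obtain L where L: "eigenflag B {0} S L"
    using eigenflag_exists[of "{0}" B S] S vec.subspace_0[OF S] by (auto simp: vec.subspace_single_0)
  moreover have "sum_mset L = -1"
  proof (rule ccontr)
    assume "sum_mset L \<noteq> -1"
    then have nz: "1 + sum_mset L \<noteq> 0" by (metis add_eq_0_iff)
    obtain \<pi> where \<pi>: "\<pi> \<in> V_dual_tensor S" "\<And>v. v \<in> S \<Longrightarrow> \<pi> v = v"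
      using projection_exists[OF S] by blast
    \<comment> \<open>The map a\<pi> is sent to a(1 + tr(B|S)) times the identity, which fixes
      a.\<close>
    define a where "a = 1 / (1 + sum_mset L)"
    have a: "a + a * sum_mset L = 1" using nz by (simp add: a_def field_simps)
    have mem: "(\<lambda>v. a *s \<pi> v) \<in> V_dual_tensor S"
      using \<pi>(1) S by (auto simp: V_dual_tensor_def vec.subspace_scale intro: vec.linear_compose_scale_right)
    have "f_fibre B S (\<lambda>v. a *s \<pi> v) = (\<lambda>v\<in>S. v)"
    proof
      fix v
      show "f_fibre B S (\<lambda>v. a *s \<pi> v) v = (\<lambda>v\<in>S. v) v"
      proof (cases "v \<in> S")
        case True
        then have "f_fibre B S (\<lambda>v. a *s \<pi> v) v = a *s v + (a * sum_mset L) *s v"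
          unfolding f_fibre_eq_trace[OF mem True] using \<pi>(2) trace_eigenflag[OF L mem] by simp
        also have "\<dots> = v" by (simp only: vec.scale_left_distrib[symmetric] a vec.scale_one)
        finally show ?thesis using True by simp
      qed (simp add: f_fibre_def)
    qed
    with mem show False using not_surj f_fibre_surj_iff_id[OF S] by blast
  qed
  ultimately show "\<exists>L. eigenflag B {0} S L \<and> sum_mset L = -1" by blast
next
  assume "\<exists>L. eigenflag B {0} S L \<and> sum_mset L = -1"
  then obtain L where L: "eigenflag B {0} S L" "sum_mset L = -1" by blast
  show "f_fibre B S ` V_dual_tensor S \<noteq> S_dual_tensor S"
  proof
    assume "f_fibre B S ` V_dual_tensor S = S_dual_tensor S"
    then obtain \<phi> where \<phi>: "\<phi> \<in> V_dual_tensor S" "f_fibre B S \<phi> = (\<lambda>v\<in>S. v)"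
      using f_fibre_surj_iff_id[OF S] by blast
    define c where "c = (\<Sum>i\<in>UNIV. (B *v \<phi> (axis i 1)) $ i)"
    \<comment> \<open>A preimage of the identity is forced to be a scalar on
      \<open>S\<close>.\<close>
    have "\<phi> v = (1 - c) *s v" if "v \<in> S" for v
    proof -
      have "\<phi> v + c *s v = v"
        using f_fibre_eq_trace[OF \<phi>(1) that, of B] \<phi>(2) that by (simp add: c_def)
      then show ?thesis by (simp add: vec.scale_left_diff_distrib eq_diff_eq)
    qed
    then have "(\<Sum>i\<in>UNIV. (B *v \<phi> (axis i 1)) $ i) = (1 - c) * sum_mset L"
      by (rule trace_eigenflag[OF L(1) \<phi>(1)])
    \<comment> \<open>With trace -1 this reads c = c - 1.\<close>
    then have "c = (1 - c) * -1" by (simp only: c_def L(2))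
    then show False by simp
  qed
qed

section \<open>Eigenvalue criterion for the degenerate locus\<close>

theorem theorem3p3:
  fixes B :: "complex^'n^'n" and k :: nat
  assumes "1 \<le> k" and "k < CARD('n) - 1"
  shows "B \<in> degenerate_locus k \<longleftrightarrow>
    (\<exists>L. L \<subseteq># eigenvalues B \<and> size L = k \<and> sum_mset L = -1)"
proof
  assume "B \<in> degenerate_locus k"
  then obtain S where S: "vec.subspace S" "vec.dim S = k"
    "f_fibre B S ` V_dual_tensor S \<noteq> S_dual_tensor S"
    by (auto simp: degenerate_locus_def grassmannian_def)
  then obtain L where L: "eigenflag B {0} S L" "sum_mset L = -1"
    using not_surj_iff_eigenflag by blast
  note inv = eigenflag_invariant[OF vec.subspace_single_0 _ L(1)]
  \<comment> \<open>Completing the flag of \<open>S\<close> to the whole space exhibits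
    \<open>L\<close> as part of the eigenvalues of \<open>B\<close>.\<close>
  then obtain M where M: "eigenflag B S UNIV M"
    using eigenflag_exists[of S B UNIV] by auto
  have "eigenvalues B = L + M"
    using eigenflag_trans[OF M L(1)] by (rule eigenvalues_eq_eigenflag)
  moreover have "size L = k" using inv S(2) by simp
  ultimately show "\<exists>L. L \<subseteq># eigenvalues B \<and> size L = k \<and> sum_mset L = -1"
    using L(2) by (intro exI[of _ L]) simp
next
  assume "\<exists>L. L \<subseteq># eigenvalues B \<and> size L = k \<and> sum_mset L = -1"
  then obtain L where L: "L \<subseteq># eigenvalues B" "size L = k" "sum_mset L = -1" by blast
  then obtain S where S: "eigenflag B {0} S L"
    using eigenflag_of_sub_eigenvalues by blast
  then have "vec.subspace S" "vec.dim S = k"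
    using eigenflag_invariant[OF vec.subspace_single_0 _ S] L(2) by simp_all
  moreover from this have "f_fibre B S ` V_dual_tensor S \<noteq> S_dual_tensor S"
    using not_surj_iff_eigenflag S L(3) by blast
  ultimately show "B \<in> degenerate_locus k"
    by (auto simp: degenerate_locus_def grassmannian_def)
qed

end
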